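(* Let $R$ be a ring (unital and associative, not necessarily commutative). Let $n\in\mathbb{N}$ and $p\in\{0,1,\ldots,n\}$. Let $q=n-p$. Let $h_{k,\,i}$ be an element of $R$ for all $k\in\mathbb{Z}$ and $i\in[n]$. Assume that $$h_{k,\,i}=0\quad\text{for all }k<0\text{ and }i>q\ (\text{with } i\in[n]).$$ For any $m\in\{0,1,\ldots,n\}$ and any $\lambda\in\mathbb{Z}^m$, define $$s_\lambda:=\operatorname{rowdet}\left(\left(h_{\lambda_i+j-i,\,i}\right)_{i,j\in[m]}\right)\in R.$$ Set $$e_{p,\,q}:=\operatorname{rowdet}\left(\left(h_{1+j-i,\,q+i}\right)_{i,j\in[p]}\right)\in R.$$ Fix an $n$-tuple $\mu\in\mathbb{Z}^n$. Assume that $\mu_i=0$ for all $i>q$ (with $i\in[n]$). Let $\overline{\mu}=(\mu_1,\mu_2,\ldots,\mu_q)$. Then $$s_{\overline{\mu}}\cdot e_{p,\,q}=\sum_{\substack{\beta\in\{0,1\}^n;\\ |\beta|=p}}s_{\mu+\beta}.$$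
   Context: $\mathbb{N}=\{0,1,2,\ldots\}$ and $[m]=\{1,2,\ldots,m\}$. For a tuple $\alpha$, $\alpha_i$ denotes its $i$-th entry, and for $\alpha\in\mathbb{Z}^n$ we set $|\alpha|:=\alpha_1+\cdots+\alpha_n$. Addition of tuples is entrywise. $S_m$ is the group of permutations of $[m]$, and $(-1)^\sigma$ is the sign of $\sigma\in S_m$. For an $m\times m$-matrix $A=(a_{i,j})_{i,j\in[m]}$ over $R$ (whose $(i,j)$-th entry is $a_{i,j}$), the row-determinant is $$\operatorname{rowdet}A:=\sum_{\sigma\in S_m}(-1)^\sigma a_{1,\sigma(1)}a_{2,\sigma(2)}\cdots a_{m,\sigma(m)}\in R$$ (factors multiplied in this order). *)

theory Defs
  imports "HOL-Combinatorics.Combinatorics" "HOL-Library.FuncSet"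
begin

text \<open>
  An \<open>m\<close>-tuple is a function on \<^typ>\<open>nat\<close> of which only the values on \<open>{1..m}\<close> matter, and an
  \<open>m \<times> m\<close>-matrix is a binary function read on \<open>{1..m} \<times> {1..m}\<close>.

  The sort \<open>{ring, monoid_mult}\<close> is that of unital associative rings, not necessarily commutative.
  Unlike \<^class>\<open>ring_1\<close>, it does not exclude the zero ring. Since the coercion
  from \<^typ>\<open>int\<close> is not available for it, the definition of \<^const>\<open>sign\<close> is written out
  inside the ring.
\<close>

definition rowdet :: "nat \<Rightarrow> (nat \<Rightarrow> nat \<Rightarrow> 'a) \<Rightarrow> 'a :: {ring, monoid_mult}" where
  "rowdet m A =
    (\<Sum>\<sigma> | \<sigma> permutes {1..m}.
      (if evenperm \<sigma> then 1 else - 1) * prod_list (map (\<lambda>i. A i (\<sigma> i)) [1..<Suc m]))"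

definition s_det :: "(int \<Rightarrow> nat \<Rightarrow> 'a) \<Rightarrow> nat \<Rightarrow> (nat \<Rightarrow> int) \<Rightarrow> 'a :: {ring, monoid_mult}" where
  "s_det h m lam = rowdet m (\<lambda>i j. h (lam i + int j - int i) i)"

definition e_det :: "(int \<Rightarrow> nat \<Rightarrow> 'a) \<Rightarrow> nat \<Rightarrow> nat \<Rightarrow> 'a :: {ring, monoid_mult}" where
  "e_det h p q = rowdet p (\<lambda>i j. h (1 + int j - int i) (q + i))"

end

theory Submission
  imports Defs
begin

text \<open>
  Expand every \<open>s\<^sub>\<mu>\<^sub>+\<^sub>\<beta>\<close> as a sum over permutations \<open>\<sigma>\<close>. For fixed \<open>\<sigma>\<close>, replacing
  \<open>\<beta>\<close> by \<open>\<beta> \<circ> \<sigma>\<close> turns the row shifts into column shifts: entry \<open>j\<close> of row \<open>i\<close> becomes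
  \<open>h\<^bsub>\<mu>\<^sub>i + j + \<beta>\<^sub>j - i, i\<^esub>\<close>. A row-determinant with two equal columns vanishes even over a
  noncommutative ring, and a descent \<open>\<beta>\<^sub>j = 1\<close>, \<open>\<beta>\<^sub>j\<^sub>+\<^sub>1 = 0\<close> makes the columns \<open>j\<close> and
  \<open>j + 1\<close> equal. So only \<open>\<beta> = (0, \<dots>, 0, 1, \<dots>, 1)\<close> survives, and the remaining matrix is
  block upper triangular with diagonal blocks giving the two factors.
\<close>

section \<open>Congruence and equal columns for row-determinants\<close>

lemma rowdet_cong:
  assumes "\<And>i j. i \<in> {1..m} \<Longrightarrow> j \<in> {1..m} \<Longrightarrow> A i j = B i j"
  shows "rowdet m A = rowdet m B"
  unfolding rowdet_def
proof (intro sum.cong refl arg_cong[where f = "\<lambda>x. _ * prod_list x"] map_cong)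
  fix \<sigma> i
  assume "\<sigma> \<in> {\<sigma>. \<sigma> permutes {1..m}}" "i \<in> set [1..<Suc m]"
  then show "A i (\<sigma> i) = B i (\<sigma> i)"
    using permutes_in_image[of \<sigma> "{1..m}" i] by (intro assms) auto
qed

text \<open>Composing \<open>\<sigma>\<close> on the left with the transposition of \<open>j\<close>
  and \<open>k\<close> changes only the column chosen in each row. Factors are ordered by row, so
  each product keeps its value while the parity flips: even and odd terms cancel in pairs without
  commuting any entries.\<close>

lemma rowdet_equal_columns:
  assumes jk: "j \<in> {1..m}" "k \<in> {1..m}" "j \<noteq> k"
    and eq: "\<And>i. i \<in> {1..m} \<Longrightarrow> A i j = A i k"
  shows "rowdet m A = 0"
proof -
  let ?P = "{\<sigma>. \<sigma> permutes {1..m}}"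
  let ?f = "\<lambda>\<sigma>. prod_list (map (\<lambda>i. A i (\<sigma> i)) [1..<Suc m])"
  let ?t = "transpose j k"
  have t: "?t permutes {1..m}"
    using jk by (simp add: permutes_swap_id)
  have f: "?f (?t \<circ> \<sigma>) = ?f \<sigma>" if "\<sigma> permutes {1..m}" for \<sigma>
    by (rule arg_cong[where f = prod_list], rule map_cong)
      (auto simp: transpose_def eq simp del: upt_Suc)
  have even: "evenperm (?t \<circ> \<sigma>) \<longleftrightarrow> \<not> evenperm \<sigma>" if "\<sigma> permutes {1..m}" for \<sigma>
    using that t jk by (subst evenperm_comp)
      (auto simp: evenperm_swap permutation_permutes intro!: exI[of _ "{1..m}"])
  have "sum ?f {\<sigma> \<in> ?P. evenperm \<sigma>} = sum ?f {\<sigma> \<in> ?P. \<not> evenperm \<sigma>}"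
  proof (rule sum.reindex_bij_witness[where i = "\<lambda>\<sigma>. ?t \<circ> \<sigma>" and j = "\<lambda>\<sigma>. ?t \<circ> \<sigma>"])
    fix \<sigma> :: "nat \<Rightarrow> nat"
    show "?t \<circ> (?t \<circ> \<sigma>) = \<sigma>" "?t \<circ> (?t \<circ> \<sigma>) = \<sigma>"
      by (auto simp: fun_eq_iff)
    show "?t \<circ> \<sigma> \<in> {\<sigma> \<in> ?P. \<not> evenperm \<sigma>}" "?f (?t \<circ> \<sigma>) = ?f \<sigma>"
      if "\<sigma> \<in> {\<sigma> \<in> ?P. evenperm \<sigma>}"
      using that f[of \<sigma>] even[of \<sigma>] permutes_compose[OF _ t, of \<sigma>] by simp_all
    show "?t \<circ> \<sigma> \<in> {\<sigma> \<in> ?P. evenperm \<sigma>}" if "\<sigma> \<in> {\<sigma> \<in> ?P. \<not> evenperm \<sigma>}"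
      using that even[of \<sigma>] permutes_compose[OF _ t, of \<sigma>] by simp
  qed
  moreover have "rowdet m A =
      (\<Sum>\<sigma> \<in> ?P. if evenperm \<sigma> then ?f \<sigma> else - ?f \<sigma>)"
    unfolding rowdet_def by (intro sum.cong) auto
  then have "rowdet m A = sum ?f {\<sigma> \<in> ?P. evenperm \<sigma>} - sum ?f {\<sigma> \<in> ?P. \<not> evenperm \<sigma>}"
    by (simp add: sum.If_cases finite_permutations sum_negf Collect_conj_eq Collect_neg_eq)
  ultimately show ?thesis
    by simp
qed

section \<open>Block upper triangular matrices\<close>

text \<open>Parametrizes the terms that survive in a block triangular row-determinant. Restricting
  \<open>\<pi>\<close> to each block, with the identity elsewhere, inverts the composition
  map.\<close>

lemma bij_betw_compose_permutes_disjoint: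
  assumes "S \<inter> T = {}"
  shows "bij_betw (\<lambda>(\<sigma>, \<tau>). \<sigma> \<circ> \<tau>) ({\<sigma>. \<sigma> permutes S} \<times> {\<tau>. \<tau> permutes T})
    {\<pi>. \<pi> permutes S \<union> T \<and> \<pi> ` T = T}"
proof (rule bij_betwI[where g = "\<lambda>\<pi>. (restrict_id \<pi> S, restrict_id \<pi> T)"])
  show "(\<lambda>(\<sigma>, \<tau>). \<sigma> \<circ> \<tau>) \<in> {\<sigma>. \<sigma> permutes S} \<times> {\<tau>. \<tau> permutes T} \<rightarrow>
      {\<pi>. \<pi> permutes S \<union> T \<and> \<pi> ` T = T}"
  proof safe
    fix \<sigma> \<tau> assume st: "\<sigma> permutes S" "\<tau> permutes T"
    show "\<sigma> \<circ> \<tau> permutes S \<union> T"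
      by (rule permutes_compose) (use st in \<open>auto intro: permutes_subset\<close>)
    have "\<sigma> ` T = T"
    proof -
      have "\<sigma> x = x" if "x \<in> T" for x
        using st(1) assms that by (meson disjoint_iff permutes_not_in)
      then show ?thesis
        by simp
    qed
    then have "(\<sigma> \<circ> \<tau>) ` T = T"
      using st(2) by (metis image_comp permutes_image)
    then show "\<And>x. x \<in> T \<Longrightarrow> (\<sigma> \<circ> \<tau>) x \<in> T" "\<And>x. x \<in> T \<Longrightarrow> x \<in> (\<sigma> \<circ> \<tau>) ` T"
      by auto
  qed
next
  show "(\<lambda>\<pi>. (restrict_id \<pi> S, restrict_id \<pi> T)) \<in> {\<pi>. \<pi> permutes S \<union> T \<and> \<pi> ` T = T} \<rightarrow>
      {\<sigma>. \<sigma> permutes S} \<times> {\<tau>. \<tau> permutes T}"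
  proof safe
    fix \<pi> assume p: "\<pi> permutes S \<union> T" "\<pi> ` T = T"
    \<comment> \<open>By injectivity, preserving \<open>T\<close> forces \<open>\<pi>\<close> to
      preserve the rest of \<open>S \<union> T\<close>; this makes the restriction to
      \<open>S\<close> a permutation too.\<close>
    have "\<pi> ` S = S"
    proof -
      have "\<pi> ` (S \<union> T - T) = \<pi> ` (S \<union> T) - \<pi> ` T"
        by (rule image_set_diff) (rule permutes_inj[OF p(1)])
      moreover have "S \<union> T - T = S"
        using assms by auto
      ultimately show ?thesis
        using p permutes_image[OF p(1)] by simp
    qed
    then show "restrict_id \<pi> S permutes S" "restrict_id \<pi> T permutes T"
      using p by (auto intro!: permutes_restrict_id simp: bij_betw_def permutes_inj_on)
  qed
next
  fix x assume "x \<in> {\<sigma>. \<sigma> permutes S} \<times> {\<tau>. \<tau> permutes T}"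
  then obtain \<sigma> \<tau> where x: "x = (\<sigma>, \<tau>)" "\<sigma> permutes S" "\<tau> permutes T"
    by auto
  have "restrict_id (\<sigma> \<circ> \<tau>) S i = \<sigma> i" for i
    using x assms by (auto simp: restrict_id_def permutes_not_in[of \<sigma>]) (metis disjoint_iff permutes_not_in)
  moreover have "restrict_id (\<sigma> \<circ> \<tau>) T i = \<tau> i" for i
    using x assms by (auto simp: restrict_id_def permutes_not_in[of \<tau>])
      (metis disjoint_iff permutes_not_in permutes_in_image)
  ultimately show "(\<lambda>\<pi>. (restrict_id \<pi> S, restrict_id \<pi> T)) ((\<lambda>(\<sigma>, \<tau>). \<sigma> \<circ> \<tau>) x) = x"
    using x by auto
next
  fix \<pi> assume "\<pi> \<in> {\<pi>. \<pi> permutes S \<union> T \<and> \<pi> ` T = T}"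
  then have p: "\<pi> permutes S \<union> T" "\<pi> ` T = T"
    by auto
  have "restrict_id \<pi> S (restrict_id \<pi> T i) = \<pi> i" for i
  proof (cases "i \<in> T")
    case True
    then have "\<pi> i \<in> T" "\<pi> i \<notin> S"
      using p(2) assms by auto
    then show ?thesis
      using True by simp
  qed (use permutes_not_in[OF p(1), of i] in \<open>cases "i \<in> S"; simp\<close>)
  then show "(\<lambda>(\<sigma>, \<tau>). \<sigma> \<circ> \<tau>) (restrict_id \<pi> S, restrict_id \<pi> T) = \<pi>"
    by auto
qed

text \<open>A permutation contributes only if it keeps the bottom rows in the right-hand columns, so
  it splits into one permutation per block. Top-row factors already precede bottom-row factors, so
  separating the product moves only the signs, which are central.\<close>

lemma rowdet_block_triangular:
  assumes zero: "\<And>i j. i \<in> {Suc q..q + p} \<Longrightarrow> j \<in> {1..q} \<Longrightarrow> A i j = 0"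
  shows "rowdet (q + p) A = rowdet q A * rowdet p (\<lambda>i j. A (q + i) (q + j))"
proof -
  let ?S = "{1..q}" and ?T = "{Suc q..q + p}"
  let ?sg = "\<lambda>\<sigma>. if evenperm \<sigma> then 1 else - 1 :: 'a"
  let ?f = "\<lambda>\<sigma>. prod_list (map (\<lambda>i. A i (\<sigma> i)) [1..<Suc q])"
  let ?g = "\<lambda>\<tau>. prod_list (map (\<lambda>i. A i (\<tau> i)) [Suc q..<Suc (q + p)])"
  let ?t = "\<lambda>\<pi>. ?sg \<pi> * prod_list (map (\<lambda>i. A i (\<pi> i)) [1..<Suc (q + p)])"
  let ?G = "{\<pi>. \<pi> permutes ?S \<union> ?T \<and> \<pi> ` ?T = ?T}"
  have ST: "{1..q + p} = ?S \<union> ?T"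
    by auto
  have "rowdet (q + p) A = sum ?t {\<pi>. \<pi> permutes ?S \<union> ?T}"
    unfolding rowdet_def ST ..
  also have "\<dots> = sum ?t ?G"
  proof (rule sum.mono_neutral_right)
    show "\<forall>\<pi> \<in> {\<pi>. \<pi> permutes ?S \<union> ?T} - ?G. ?t \<pi> = 0"
    proof
      fix \<pi> assume "\<pi> \<in> {\<pi>. \<pi> permutes ?S \<union> ?T} - ?G"
      then have p: "\<pi> permutes ?S \<union> ?T" "\<pi> ` ?T \<noteq> ?T"
        by auto
      \<comment> \<open>An injective self-map of a finite set is onto, so failing to preserve
        \<open>?T\<close> means sending some bottom row to one of the first \<open>q\<close>
        columns.\<close>
      have "\<not> \<pi> ` ?T \<subseteq> ?T"
        using endo_inj_surj[of ?T \<pi>] p by (auto simp: permutes_inj_on)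
      then obtain i where i: "i \<in> ?T" "\<pi> i \<notin> ?T"
        by blast
      then have "\<pi> i \<in> ?S"
        using permutes_in_image[OF p(1), of i] by blast
      then have "A i (\<pi> i) = 0"
        using zero i by blast
      then have "0 \<in> set (map (\<lambda>i. A i (\<pi> i)) [1..<Suc (q + p)])"
        using i by (simp only: set_map set_upt, intro image_eqI[of _ _ i]) auto
      then obtain xs ys where "map (\<lambda>i. A i (\<pi> i)) [1..<Suc (q + p)] = xs @ 0 # ys"
        by (meson split_list)
      then show "?t \<pi> = 0"
        by simp
    qed
  qed (auto simp: finite_permutations)
  also have "\<dots> = (\<Sum>(\<sigma>, \<tau>) \<in> {\<sigma>. \<sigma> permutes ?S} \<times> {\<tau>. \<tau> permutes ?T}. ?t (\<sigma> \<circ> \<tau>))"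
    by (subst sum.reindex_bij_betw[OF bij_betw_compose_permutes_disjoint, symmetric])
      (auto simp: case_prod_unfold)
  also have "\<dots> = (\<Sum>(\<sigma>, \<tau>) \<in> {\<sigma>. \<sigma> permutes ?S} \<times> {\<tau>. \<tau> permutes ?T}.
      (?sg \<sigma> * ?f \<sigma>) * (?sg \<tau> * ?g \<tau>))"
  proof (intro sum.cong refl, safe)
    fix \<sigma> \<tau> assume st: "\<sigma> permutes ?S" "\<tau> permutes ?T"
    have "evenperm (\<sigma> \<circ> \<tau>) \<longleftrightarrow> evenperm \<sigma> = evenperm \<tau>"
      using st by (intro evenperm_comp) (auto simp: permutation_permutes)
    then have sg: "?sg (\<sigma> \<circ> \<tau>) = ?sg \<sigma> * ?sg \<tau>"
      by auto
    have "(\<sigma> \<circ> \<tau>) i = \<sigma> i" if "i \<in> ?S" for i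
      using that st(2) by (simp add: permutes_not_in)
    then have f: "map (\<lambda>i. A i ((\<sigma> \<circ> \<tau>) i)) [1..<Suc q] = map (\<lambda>i. A i (\<sigma> i)) [1..<Suc q]"
      by (intro map_cong) auto
    have "(\<sigma> \<circ> \<tau>) i = \<tau> i" if "i \<in> ?T" for i
      using permutes_in_image[OF st(2), of i] that permutes_not_in[OF st(1), of "\<tau> i"] by simp
    then have g: "map (\<lambda>i. A i ((\<sigma> \<circ> \<tau>) i)) [Suc q..<Suc (q + p)] =
        map (\<lambda>i. A i (\<tau> i)) [Suc q..<Suc (q + p)]"
      by (intro map_cong) auto
    have split: "[1..<Suc (q + p)] = [1..<Suc q] @ [Suc q..<Suc (q + p)]"
      using upt_add_eq_append[of 1 "Suc q" p] by simp
    have "?t (\<sigma> \<circ> \<tau>) = (?sg \<sigma> * ?sg \<tau>) * (?f \<sigma> * ?g \<tau>)"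
      unfolding sg split map_append f g prod_list.append ..
    also have "\<dots> = (?sg \<sigma> * ?f \<sigma>) * (?sg \<tau> * ?g \<tau>)"
      by (simp add: mult.assoc)
    finally show "?t (\<sigma> \<circ> \<tau>) = (?sg \<sigma> * ?f \<sigma>) * (?sg \<tau> * ?g \<tau>)" .
  qed
  also have "\<dots> = (\<Sum>\<sigma> | \<sigma> permutes ?S. ?sg \<sigma> * ?f \<sigma>) * (\<Sum>\<tau> | \<tau> permutes ?T. ?sg \<tau> * ?g \<tau>)"
    by (simp only: sum_product sum.cartesian_product)
  also have "(\<Sum>\<tau> | \<tau> permutes ?T. ?sg \<tau> * ?g \<tau>) = rowdet p (\<lambda>i j. A (q + i) (q + j))"
    unfolding rowdet_def
  \<comment> \<open>Relabelling by the shift by \<open>q\<close> preserves parity, and, being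
    monotone, also the order of the factors.\<close>
  proof (rule sum.reindex_bij_witness[where i = "map_permutation {1..p} ((+) q)"
        and j = "map_permutation ?T (\<lambda>i. i - q)"])
    have bij: "bij_betw ((+) q) {1..p} ?T" "bij_betw (\<lambda>i. i - q) ?T {1..p}"
      by (rule bij_betwI[where g = "\<lambda>i. i - q"]; auto; fail)
        (rule bij_betwI[where g = "(+) q"]; auto; fail)
    fix \<tau> assume "\<tau> \<in> {\<tau>. \<tau> permutes ?T}"
    then have t: "\<tau> permutes ?T"
      by simp
    let ?u = "map_permutation ?T (\<lambda>i. i - q) \<tau>"
    show "map_permutation {1..p} ((+) q) ?u = \<tau>"
      by (rule map_permutation_compose_inv[OF bij(2) t]) auto
    show "?u \<in> {\<sigma>. \<sigma> permutes {1..p}}"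
      using map_permutation_permutes[OF bij(2) t] by simp
    have "evenperm ?u \<longleftrightarrow> evenperm \<tau>"
      using bij(2) t by (intro evenperm_map_permutation) (auto simp: bij_betw_def)
    moreover have "?g \<tau> = prod_list (map (\<lambda>i. A (q + i) (q + ?u i)) [1..<Suc p])"
    proof -
      have "[Suc q..<Suc (q + p)] = map ((+) q) [1..<Suc p]"
        by (rule nth_equalityI) (auto simp del: upt_Suc)
      moreover have "q + ?u i = \<tau> (q + i)" if "i \<in> {1..p}" for i
        using map_permutation_apply[of "\<lambda>i. i - q" ?T "q + i" \<tau>] bij(2) that
          permutes_in_image[OF t, of "q + i"] by (auto simp: bij_betw_def)
      ultimately show ?thesis
        by (auto simp: less_Suc_eq_le simp del: upt_Suc intro!: arg_cong[where f = prod_list])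
    qed
    ultimately show "?sg ?u * prod_list (map (\<lambda>i. A (q + i) (q + ?u i)) [1..<Suc p]) = ?sg \<tau> * ?g \<tau>"
      by simp
  next
    have bij: "bij_betw ((+) q) {1..p} ?T"
      by (rule bij_betwI[where g = "\<lambda>i. i - q"]) auto
    fix \<sigma> assume "\<sigma> \<in> {\<sigma>. \<sigma> permutes {1..p}}"
    then have s: "\<sigma> permutes {1..p}"
      by simp
    show "map_permutation ?T (\<lambda>i. i - q) (map_permutation {1..p} ((+) q) \<sigma>) = \<sigma>"
      by (rule map_permutation_compose_inv[OF bij s]) auto
    show "map_permutation {1..p} ((+) q) \<sigma> \<in> {\<tau>. \<tau> permutes ?T}"
      using map_permutation_permutes[OF bij s] by simp
  qed
  finally show ?thesis
    unfolding rowdet_def .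
qed

section \<open>Sums over shifts by zero-one tuples\<close>

text \<open>Permuting the coordinates of \<open>\<beta>\<close> preserves its range and its sum. The
  permutation used depends on \<open>\<sigma>\<close>, so the two sums are exchanged first; the
  equality arises only after summing over \<open>\<beta>\<close>.\<close>

lemma sum_rowdet_shift_rows_eq_columns:
  fixes A :: "nat \<Rightarrow> int \<Rightarrow> 'a :: {ring, monoid_mult}"
  defines "B \<equiv> \<lambda>n k. {\<beta>. \<beta> \<in> {1..n} \<rightarrow>\<^sub>E {0, 1} \<and> (\<Sum>i = 1..n. \<beta> i) = (k::int)}"
  shows "(\<Sum>\<beta> \<in> B n k. rowdet n (\<lambda>i j. A i (int j + \<beta> i))) =
    (\<Sum>\<beta> \<in> B n k. rowdet n (\<lambda>i j. A i (int j + \<beta> j)))"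
proof -
  let ?f = "\<lambda>\<sigma> \<beta>. prod_list (map (\<lambda>i. A i (int (\<sigma> i) + \<beta> i)) [1..<Suc n])"
  have *: "(\<Sum>\<beta> \<in> B n k. ?f \<sigma> \<beta>) = (\<Sum>\<beta> \<in> B n k. ?f \<sigma> (\<lambda>i. \<beta> (\<sigma> i)))"
    if s: "\<sigma> permutes {1..n}" for \<sigma>
  \<comment> \<open>Tuples are extensional, so each composite is restricted to
    \<open>{1..n}\<close>, which keeps the value outside at \<open>undefined\<close>.\<close>
  proof (rule sum.reindex_bij_witness[where i = "\<lambda>\<beta>. restrict (\<beta> \<circ> \<sigma>) {1..n}"
        and j = "\<lambda>\<beta>. restrict (\<beta> \<circ> inv \<sigma>) {1..n}"])
    have mem: "restrict (\<beta> \<circ> \<tau>) {1..n} \<in> B n k" if "\<beta> \<in> B n k" "\<tau> permutes {1..n}" for \<beta> \<tau>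
    proof -
      have "(\<Sum>i = 1..n. \<beta> (\<tau> i)) = (\<Sum>i = 1..n. \<beta> i)"
        using sum.permute[OF that(2), of \<beta>] by (simp add: o_def)
      then show ?thesis
        using that permutes_in_image[OF that(2)] unfolding B_def by (auto simp: PiE_iff)
    qed
    have s': "inv \<sigma> permutes {1..n}"
      using s by (rule permutes_inv)
    fix \<beta> assume b: "\<beta> \<in> B n k"
    then have ext: "\<beta> \<in> extensional {1..n}"
      by (auto simp: B_def PiE_iff)
    show "restrict (\<beta> \<circ> inv \<sigma>) {1..n} \<in> B n k" "restrict (\<beta> \<circ> \<sigma>) {1..n} \<in> B n k"
      using mem b s s' by auto
    show "restrict (restrict (\<beta> \<circ> inv \<sigma>) {1..n} \<circ> \<sigma>) {1..n} = \<beta>"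
      "restrict (restrict (\<beta> \<circ> \<sigma>) {1..n} \<circ> inv \<sigma>) {1..n} = \<beta>"
      using permutes_in_image[OF s] permutes_in_image[OF s'] permutes_inverses[OF s] ext
      by (auto simp: restrict_def extensional_def fun_eq_iff)
    show "?f \<sigma> (\<lambda>i. restrict (\<beta> \<circ> inv \<sigma>) {1..n} (\<sigma> i)) = ?f \<sigma> \<beta>"
      using permutes_in_image[OF s] permutes_inverses[OF s]
      by (intro arg_cong[where f = prod_list] map_cong) (auto simp: restrict_def)
  qed
  have "(\<Sum>\<beta> \<in> B n k. rowdet n (\<lambda>i j. A i (int j + \<beta> i))) =
      (\<Sum>\<sigma> | \<sigma> permutes {1..n}. (if evenperm \<sigma> then 1 else - 1) * (\<Sum>\<beta> \<in> B n k. ?f \<sigma> \<beta>))"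
    unfolding rowdet_def sum_distrib_left by (rule sum.swap)
  also have "\<dots> = (\<Sum>\<sigma> | \<sigma> permutes {1..n}. (if evenperm \<sigma> then 1 else - 1) *
      (\<Sum>\<beta> \<in> B n k. ?f \<sigma> (\<lambda>i. \<beta> (\<sigma> i))))"
    using * by (intro sum.cong) auto
  also have "\<dots> = (\<Sum>\<beta> \<in> B n k. rowdet n (\<lambda>i j. A i (int j + \<beta> j)))"
    unfolding rowdet_def sum_distrib_left by (rule sum.swap)
  finally show ?thesis .
qed

text \<open>Without a descent, a 1 propagates to every later position up to \<open>n\<close>, so the
  ones form a final segment, whose length is the sum \<open>p\<close>.\<close>

lemma zero_one_tuple_without_descent:
  fixes \<beta> :: "nat \<Rightarrow> int"
  assumes b: "\<beta> \<in> {1..n} \<rightarrow>\<^sub>E {0, 1}" and sum: "(\<Sum>i = 1..n. \<beta> i) = int p"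
    and no: "\<And>j. j \<in> {1..<n} \<Longrightarrow> \<beta> j = 1 \<Longrightarrow> \<beta> (Suc j) \<noteq> 0"
  shows "\<beta> = (\<lambda>i\<in>{1..n}. if i > n - p then 1 else 0)"
proof -
  let ?S = "{i \<in> {1..n}. \<beta> i = 1}"
  have val: "\<beta> i = 0 \<or> \<beta> i = 1" if "i \<in> {1..n}" for i
    using b that by (auto simp: PiE_iff)
  have "(\<Sum>i = 1..n. \<beta> i) = (\<Sum>i = 1..n. if \<beta> i = 1 then 1 else 0)"
    using val by (intro sum.cong) auto
  also have "\<dots> = int (card ?S)"
    by (simp add: sum.If_cases Int_def)
  finally have card: "card ?S = p"
    using sum by simp
  have pn: "p \<le> n"
  proof -
    have "card ?S \<le> card {1..n}"
      by (rule card_mono) auto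
    then show ?thesis
      using card by simp
  qed
  \<comment> \<open>If \<open>i\<close> lies in \<open>?S\<close>, so do all
    \<open>n + 1 - i\<close> positions from \<open>i\<close> on, whence
    \<open>n + 1 - i \<le> p\<close>. One inclusion suffices, as both sets have \<open>p\<close>
    elements.\<close>
  have "?S \<subseteq> {Suc (n - p)..n}"
  proof
    fix i assume i: "i \<in> ?S"
    have "k \<in> ?S" if "i \<le> k" "k \<le> n" for k
      using that
    proof (induction k rule: dec_induct)
      case (step k)
      then show ?case
        using no[of k] val[of "Suc k"] by auto
    qed (use i in auto)
    then have "{i..n} \<subseteq> ?S"
      by auto
    then have "card {i..n} \<le> p"
      using card_mono[of ?S "{i..n}"] card by simp
    then show "i \<in> {Suc (n - p)..n}"
      using i by auto
  qed
  then have "?S = {Suc (n - p)..n}"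
    using card pn by (intro card_subset_eq) auto
  then have S: "i \<in> ?S \<longleftrightarrow> i \<in> {Suc (n - p)..n}" for i
    by (rule eqset_imp_iff)
  have "\<beta> i = 1 \<longleftrightarrow> i > n - p" if "i \<in> {1..n}" for i
    using that S[of i] by auto
  then show ?thesis
    using val b by (intro extensionalityI[of _ "{1..n}"]) (auto simp: PiE_iff)
qed

text \<open>The cancellation needs only entries given by a row and an integer column position. The
  surviving tuple pushes the last \<open>p\<close> columns one place to the right, so position
  \<open>n - p + 1\<close> is skipped.\<close>

lemma sum_rowdet_shift_rows:
  fixes A :: "nat \<Rightarrow> int \<Rightarrow> 'a :: {ring, monoid_mult}"
  assumes "p \<le> n"
  shows "(\<Sum>\<beta> | \<beta> \<in> {1..n} \<rightarrow>\<^sub>E {0, 1} \<and> (\<Sum>i = 1..n. \<beta> i) = int p.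
      rowdet n (\<lambda>i j. A i (int j + \<beta> i))) =
    rowdet n (\<lambda>i j. A i (int j + (if j > n - p then 1 else 0)))"
proof -
  define B where "B = {\<beta>. \<beta> \<in> {1..n} \<rightarrow>\<^sub>E {0, 1 :: int} \<and> (\<Sum>i = 1..n. \<beta> i) = int p}"
  define \<epsilon> where "\<epsilon> = (\<lambda>i\<in>{1..n}. if i > n - p then 1 else 0 :: int)"
  let ?r = "\<lambda>\<beta>. rowdet n (\<lambda>i j. A i (int j + \<beta> j))"
  have "(\<Sum>i = 1..n. \<epsilon> i) = (\<Sum>i \<in> {Suc (n - p)..n}. 1)"
    unfolding \<epsilon>_def by (intro sum.mono_neutral_cong_right) auto
  then have \<epsilon>: "\<epsilon> \<in> B"
    using assms by (auto simp: B_def \<epsilon>_def)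
  have "finite B"
    unfolding B_def by (rule finite_subset[of _ "{1..n} \<rightarrow>\<^sub>E {0, 1}"]) (auto intro: finite_PiE)
  moreover have "?r \<beta> = 0" if "\<beta> \<in> B - {\<epsilon>}" for \<beta>
  proof -
    \<comment> \<open>At a descent, column \<open>j\<close> is read at position \<open>j + 1\<close>
      by its shift, and column \<open>j + 1\<close> is read there unshifted.\<close>
    obtain j where j: "j \<in> {1..<n}" "\<beta> j = 1" "\<beta> (Suc j) = 0"
      using zero_one_tuple_without_descent[of \<beta> n p] \<open>\<beta> \<in> B - {\<epsilon>}\<close>
      unfolding B_def \<epsilon>_def by blast
    show ?thesis
      by (rule rowdet_equal_columns[of j _ "Suc j"]) (use j in \<open>auto simp: add.commute\<close>)
  qed
  ultimately have "sum ?r B = ?r \<epsilon>"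
    using sum.mono_neutral_right[of B "{\<epsilon>}" ?r] \<epsilon> by auto
  also have "\<dots> = rowdet n (\<lambda>i j. A i (int j + (if j > n - p then 1 else 0)))"
    by (rule rowdet_cong) (simp add: \<epsilon>_def)
  finally show ?thesis
    using sum_rowdet_shift_rows_eq_columns[of n A "int p"] by (simp add: B_def)
qed

theorem corollary4p12:
  fixes h :: "int \<Rightarrow> nat \<Rightarrow> 'a :: {ring, monoid_mult}"
    and n p q :: nat
    and \<mu> \<mu>' :: "nat \<Rightarrow> int"
  assumes "p \<in> {0..n}"
    and "q = n - p"
    and "\<And>k i. k < 0 \<Longrightarrow> i \<in> {1..n} \<Longrightarrow> i > q \<Longrightarrow> h k i = 0"
    and "\<And>i. i \<in> {1..n} \<Longrightarrow> i > q \<Longrightarrow> \<mu> i = 0"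
    and "\<mu>' = restrict \<mu> {1..q}"
  shows "s_det h q \<mu>' * e_det h p q =
    (\<Sum>\<beta> | \<beta> \<in> {1..n} \<rightarrow>\<^sub>E {0, 1} \<and> (\<Sum>i = 1..n. \<beta> i) = int p.
      s_det h n (\<lambda>i. \<mu> i + \<beta> i))"
proof -
  have n: "n = q + p" and p: "p \<le> n"
    using assms(1,2) by auto
  \<comment> \<open>The column position is an integer argument, so that a shift by
    \<open>\<beta>\<close> can be attributed to the row or to the column. \<open>M\<close> is the
    matrix that survives.\<close>
  define A where "A = (\<lambda>i k. h (\<mu> i + k - int i) i)"
  define M where "M = (\<lambda>i j. A i (int j + (if j > q then 1 else 0)))"
  have "(\<Sum>\<beta> | \<beta> \<in> {1..n} \<rightarrow>\<^sub>E {0, 1} \<and> (\<Sum>i = 1..n. \<beta> i) = int p.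
      s_det h n (\<lambda>i. \<mu> i + \<beta> i)) = rowdet n M"
    using sum_rowdet_shift_rows[OF p, of A] assms(2)
    by (simp add: s_det_def A_def M_def algebra_simps)
  also have "\<dots> = rowdet q M * rowdet p (\<lambda>i j. M (q + i) (q + j))"
    unfolding n
  proof (rule rowdet_block_triangular)
    \<comment> \<open>Here \<open>\<mu> i = 0\<close> and column \<open>j\<close> is unshifted, so
      \<open>h\<close> has the negative index \<open>j - i\<close>.\<close>
    fix i j assume "i \<in> {Suc q..q + p}" "j \<in> {1..q}"
    then show "M i j = 0"
      using assms(3,4)[of i] assms(3)[of "int j - int i" i] n by (simp add: M_def A_def)
  qed
  also have "rowdet q M = s_det h q \<mu>'"
    unfolding s_det_def assms(5) by (rule rowdet_cong) (simp add: M_def A_def)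
  \<comment> \<open>In this block \<open>\<mu>\<close> vanishes and the offsets \<open>q\<close>
    cancel; the column shift supplies the \<open>1\<close> in the index \<open>1 + j - i\<close> of
    \<open>e_det\<close>.\<close>
  also have "rowdet p (\<lambda>i j. M (q + i) (q + j)) = e_det h p q"
    unfolding e_det_def
    by (rule rowdet_cong) (use assms(4) n in \<open>simp add: M_def A_def algebra_simps\<close>)
  finally show ?thesis ..
qed

end
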